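(* Let $N\ge 1$, $p\in(1,\infty)$ and let $\Omega\subseteq\mathbb{R}^N$ be a bounded open set. There is a constant $k_0$ depending only on $N$ and $p$ such that for every $u\in X_{L_{\Delta_p}}(\Omega)$, $$\frac{p^2}{N}\int_\Omega |u|^p\ln|u|\,dx\;\le\;\mathcal{E}_{L_{\Delta_p}}(u,u)+\frac{p^2}{N}\|u\|_{L^p(\Omega)}^p\ln\|u\|_{L^p(\Omega)}+k_0\|u\|_{L^p(\Omega)}^p .$$
   Context: Convention: $t^p\ln t=0$ at $t=0$. Functions on $\Omega$ are extended by $0$ to $\mathbb{R}^N$. $C_{N,p}:=\frac{p\,\Gamma(N/2)}{2\pi^{N/2}}$, $\;[u]_{X_{L_{\Delta_p}}(\Omega)}^p:=C_{N,p}\iint_{x,y\in\mathbb{R}^N,\,|x-y|\le 1}\frac{|u(x)-u(y)|^p}{|x-y|^N}\,dx\,dy$, and $X_{L_{\Delta_p}}(\Omega):=\{u\in L^p(\Omega): [u]_{X_{L_{\Delta_p}}(\Omega)}<\infty,\ u=0\text{ in }\mathbb{R}^N\setminus\Omega\}$. Let $h(t):=|t|^{p-2}t$ (with $h(0)=0$) and $\Upsilon(z_1,z_2,t_1,t_2):=h(z_1-z_2)(t_1-t_2)-h(z_1)t_1-h(z_2)t_2$. For $u,v\in X_{L_{\Delta_p}}(\Omega)$, $$\mathcal{E}_{L_{\Delta_p}}(u,v):=\mathcal{E}_p(u,v)+\mathcal{F}_p(u,v)+\rho_N\int_{\mathbb{R}^N}h(u)v\,dx,$$ $$\mathcal{E}_p(u,v):=\frac{C_{N,p}}{2}\iint_{|x-y|\le1}\frac{h(u(x)-u(y))(v(x)-v(y))}{|x-y|^N}\,dx\,dy,$$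 $$\mathcal{F}_p(u,v):=\frac{C_{N,p}}{2}\iint_{|x-y|\ge1}\frac{\Upsilon(u(x),u(y),v(x),v(y))}{|x-y|^N}\,dx\,dy,$$ where $\rho_N:=2\ln2-\gamma_E+\frac p2\psi_0(\frac N2)$, $\gamma_E=-\Gamma'(1)$ is the Euler–Mascheroni constant and $\psi_0=\Gamma'/\Gamma$ is the digamma function. *)

theory Defs
  imports "HOL-Analysis.Analysis"
begin

definition C_const :: "nat \<Rightarrow> real \<Rightarrow> real" where
  "C_const N p = p * Gamma (real N / 2) / (2 * pi powr (real N / 2))"

definition rho_const :: "nat \<Rightarrow> real \<Rightarrow> real" where
  "rho_const N p = 2 * ln 2 - euler_mascheroni + p / 2 * Digamma (real N / 2)"

definition in_Lp :: "real \<Rightarrow> (real ^ 'n) set \<Rightarrow> (real ^ 'n \<Rightarrow> real) \<Rightarrow> bool" where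
  "in_Lp p \<Omega> u \<longleftrightarrow> u \<in> borel_measurable (lebesgue_on \<Omega>) \<and>
     integrable (lebesgue_on \<Omega>) (\<lambda>x. \<bar>u x\<bar> powr p)"

definition Lp_norm :: "real \<Rightarrow> (real ^ 'n) set \<Rightarrow> (real ^ 'n \<Rightarrow> real) \<Rightarrow> real" where
  "Lp_norm p \<Omega> u = (LINT x|lebesgue_on \<Omega>. \<bar>u x\<bar> powr p) powr (1 / p)"

text \<open>The \<open>p\<close>-th power of the seminorm, with values in \<open>[0, \<infinity>]\<close>.\<close>

definition X_seminorm_pow :: "real \<Rightarrow> (real ^ 'n \<Rightarrow> real) \<Rightarrow> ennreal" where
  "X_seminorm_pow p u = ennreal (C_const CARD('n) p) *
     (\<integral>\<^sup>+ (x, y) \<in> {(x, y). norm (x - y) \<le> 1}.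
        ennreal (\<bar>u x - u y\<bar> powr p / norm (x - y) ^ CARD('n)) \<partial>(lebesgue \<Otimes>\<^sub>M lebesgue))"

text \<open>Elements are functions on the whole space; as these represent classes modulo
  almost everywhere equality, vanishing outside \<open>\<Omega>\<close> is required almost everywhere.\<close>

definition X_space :: "real \<Rightarrow> (real ^ 'n) set \<Rightarrow> (real ^ 'n \<Rightarrow> real) set" where
  "X_space p \<Omega> = {u. in_Lp p \<Omega> u \<and> X_seminorm_pow p u < \<infinity> \<and>
     (AE x in lebesgue. x \<notin> \<Omega> \<longrightarrow> u x = 0)}"

definition h_fun :: "real \<Rightarrow> real \<Rightarrow> real" where
  "h_fun p t = \<bar>t\<bar> powr (p - 2) * t"

definition Upsilon :: "real \<Rightarrow> real \<Rightarrow> real \<Rightarrow> real \<Rightarrow> real \<Rightarrow> real" where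
  "Upsilon p z1 z2 t1 t2 = h_fun p (z1 - z2) * (t1 - t2) - h_fun p z1 * t1 - h_fun p z2 * t2"

definition E_near :: "real \<Rightarrow> (real ^ 'n \<Rightarrow> real) \<Rightarrow> (real ^ 'n \<Rightarrow> real) \<Rightarrow> real" where
  "E_near p u v = C_const CARD('n) p / 2 *
     (LINT (x, y) : {(x, y). norm (x - y) \<le> 1} | lebesgue \<Otimes>\<^sub>M lebesgue.
        h_fun p (u x - u y) * (v x - v y) / norm (x - y) ^ CARD('n))"

definition F_far :: "real \<Rightarrow> (real ^ 'n \<Rightarrow> real) \<Rightarrow> (real ^ 'n \<Rightarrow> real) \<Rightarrow> real" where
  "F_far p u v = C_const CARD('n) p / 2 *
     (LINT (x, y) : {(x, y). norm (x - y) \<ge> 1} | lebesgue \<Otimes>\<^sub>M lebesgue.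
        Upsilon p (u x) (u y) (v x) (v y) / norm (x - y) ^ CARD('n))"

definition E_log :: "real \<Rightarrow> (real ^ 'n \<Rightarrow> real) \<Rightarrow> (real ^ 'n \<Rightarrow> real) \<Rightarrow> real" where
  "E_log p u v = E_near p u v + F_far p u v +
     rho_const CARD('n) p * (LINT x|lebesgue. h_fun p (u x) * v x)"

end

theory Submission
  imports Defs
begin

text \<open>
  Let \<open>I = \<integral>|u|\<^sup>p\<close>, \<open>f = |u|\<^sup>p / I\<close>, \<open>d = |x - y|\<^sup>N\<close> and let \<open>\<beta>\<close> be the volume of the unit ball, so that
  \<open>C\<^bsub>N,p\<^esub> \<beta> = p / N\<close>. Integrating \<open>1 / d\<close> over the shell between \<open>d = 1 / f x\<close> and \<open>d = 1\<close> gives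
  \<open>\<beta> ln (f x)\<close>. So replacing the fixed cutoff \<open>d \<ge> 1\<close> in the energy by the point-dependent cutoffs
  \<open>d f x > 1\<close> and \<open>d f y > 1\<close> for \<open>|u x|\<^sup>p\<close> and \<open>|u y|\<^sup>p\<close> produces exactly the entropy \<open>\<integral> f ln f\<close>,
  and it remains to bound the new energy from below. If \<open>|u y| \<le> |u x|\<close>, its integrand is nonnegative
  where \<open>d f x \<le> 1\<close>, and elsewhere at least \<open>- (p + 1) |u x|\<^bsup>p-1\<^esup> |u y| / d\<close>; divided by \<open>I\<close>, the product
  \<open>|u x|\<^bsup>p-1\<^esup> |u y| / d\<close> is at most \<open>f x f y\<close> if \<open>d f y \<ge> 1\<close> and at most \<open>(f x)\<^sup>2 (d f x)\<^bsup>-1-1/p\<^esup>\<close> otherwise,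
  and both of these have bounded double integrals over \<open>d f x > 1\<close>.
\<close>

section \<open>Radial integrals against Lebesgue measure\<close>

text \<open>Completion does not change the measure of Borel sets, so a cover that works for
  \<open>lborel\<close> works here too. Fubini and Tonelli on the product carrying the energies rest
  on this.\<close>

lemma sigma_finite_lebesgue: "sigma_finite_measure (lebesgue :: 'a::euclidean_space measure)"
proof
  obtain A :: "'a set set" where A: "countable A" "A \<subseteq> sets lborel" "\<Union>A = space lborel"
      "\<forall>a\<in>A. emeasure lborel a \<noteq> \<infinity>"
    using lborel.sigma_finite_countable by blast
  then show "\<exists>A::'a set set. countable A \<and> A \<subseteq> sets lebesgue \<and> \<Union>A = space lebesgue \<and>
      (\<forall>a\<in>A. emeasure lebesgue a \<noteq> \<infinity>)"
    by (intro exI[of _ A]) (auto simp: subset_iff)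
qed

interpretation lebesgue: sigma_finite_measure lebesgue
  by (rule sigma_finite_lebesgue)

interpretation lebesgue_pair: pair_sigma_finite lebesgue lebesgue ..

text \<open>Polar coordinates without a Jacobian: a ball of radius \<open>r\<close> has volume
  proportional to \<open>r ^ DIM('a)\<close>, so the sublevel sets of this power of the distance
  have volume linear in the level. Half-lines form an intersection-stable generator, so comparing
  their measures is enough.\<close>

lemma distr_norm_power_lborel:
  fixes x :: "'a::euclidean_space"
  shows "distr lborel borel (\<lambda>y. norm (x - y) ^ DIM('a)) =
    density lborel (\<lambda>t. ennreal (unit_ball_vol (DIM('a))) * indicator {0<..} t)"
    (is "?M = ?N")
proof (rule measure_eqI_generator_eq)
  show "Int_stable (range (\<lambda>a::real. {..a}))"
    by (auto simp: Int_stable_def)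
  show "range (\<lambda>a::real. {..a}) \<subseteq> Pow UNIV" by simp
  have *: "emeasure ?M {..a} = ennreal (unit_ball_vol (DIM('a)) * max 0 a)" for a
  proof -
    have "(\<lambda>y. norm (x - y) ^ DIM('a)) -` {..a} = (if a < 0 then {} else cball x (root DIM('a) a))"
    proof (cases "a < 0")
      case True
      have "\<not> norm (x - y) ^ DIM('a) \<le> a" for y
        using order_less_le_trans[OF True zero_le_power[OF norm_ge_zero]] by (simp add: not_le)
      then show ?thesis using True by auto
    next
      case False
      have "norm (x - y) ^ DIM('a) \<le> a \<longleftrightarrow> dist x y \<le> root DIM('a) a" for y
        using real_root_le_iff[of "DIM('a)" "norm (x - y) ^ DIM('a)" a]
        by (simp add: real_root_power_cancel dist_norm)
      then show ?thesis using False by auto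
    qed
    then show ?thesis
      by (auto simp: emeasure_distr emeasure_cball)
  qed
  have "emeasure ?N {..a} = ennreal (unit_ball_vol (DIM('a)) * max 0 a)" for a
  proof -
    have "emeasure ?N {..a} = (\<integral>\<^sup>+t. ennreal (unit_ball_vol (DIM('a))) * indicator {0<..a} t \<partial>lborel)"
      by (subst emeasure_density) (auto intro!: nn_integral_cong split: split_indicator)
    also have "\<dots> = ennreal (unit_ball_vol (DIM('a))) * emeasure lborel {0<..a}"
      by (rule nn_integral_cmult_indicator) simp
    also have "\<dots> = ennreal (unit_ball_vol (DIM('a)) * max 0 a)"
      by (cases "0 \<le> a") (auto simp: ennreal_mult)
    finally show ?thesis .
  qed
  with * show "emeasure ?M X = emeasure ?N X" if "X \<in> range (\<lambda>a::real. {..a})" for X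
    using that by auto
  show "sets ?M = sigma_sets UNIV (range (\<lambda>a::real. {..a}))"
    "sets ?N = sigma_sets UNIV (range (\<lambda>a::real. {..a}))"
    by (simp_all add: borel_eq_atMost sets_measure_of)
  show "range (\<lambda>i. {..real i}) \<subseteq> range (\<lambda>a::real. {..a})" by auto
  show "(\<Union>i. {..real i}) = UNIV"
    using real_arch_simple by auto
  show "emeasure ?M {..real i} \<noteq> \<infinity>" for i
    by (simp add: *)
qed

lemma nn_integral_norm_power_lebesgue:
  fixes x :: "'a::euclidean_space"
  assumes [measurable]: "F \<in> borel_measurable borel"
  shows "(\<integral>\<^sup>+y. F (norm (x - y) ^ DIM('a)) \<partial>lebesgue) =
    ennreal (unit_ball_vol (DIM('a))) * (\<integral>\<^sup>+t. F t * indicator {0<..} t \<partial>lborel)"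
proof -
  have "(\<integral>\<^sup>+y. F (norm (x - y) ^ DIM('a)) \<partial>lebesgue) =
      (\<integral>\<^sup>+y. F (norm (x - y) ^ DIM('a)) \<partial>lborel)"
    by (rule nn_integral_completion)
  also have "\<dots> = (\<integral>\<^sup>+t. F t \<partial>distr lborel borel (\<lambda>y. norm (x - y) ^ DIM('a)))"
    by (subst nn_integral_distr) auto
  also have "\<dots> = (\<integral>\<^sup>+t. ennreal (unit_ball_vol (DIM('a))) * (F t * indicator {0<..} t) \<partial>lborel)"
    unfolding distr_norm_power_lborel
    by (subst nn_integral_density) (auto simp: ac_simps)
  also have "\<dots> = ennreal (unit_ball_vol (DIM('a))) * (\<integral>\<^sup>+t. F t * indicator {0<..} t \<partial>lborel)"
    by (rule nn_integral_cmult) auto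
  finally show ?thesis .
qed

lemma nn_integral_inverse_Icc:
  fixes a b :: real
  assumes "0 < a" "a \<le> b"
  shows "(\<integral>\<^sup>+t. ennreal (1 / t) * indicator {a..b} t \<partial>lborel) = ennreal (ln (b / a))"
proof -
  have "(\<integral>\<^sup>+t. ennreal (1 / t) * indicator {a..b} t \<partial>lborel) = ennreal (ln b - ln a)"
    using assms by (intro nn_integral_FTC_Icc)
      (auto intro!: derivative_eq_intros)
  then show ?thesis using assms by (simp add: ln_div)
qed

lemma nn_integral_powr_tail:
  fixes s e :: real
  assumes "0 < s" "0 < e"
  shows "(\<integral>\<^sup>+t. ennreal (t powr (- 1 - e)) * indicator {s..} t \<partial>lborel) = ennreal (s powr - e / e)"
proof -
  have lim: "((\<lambda>t. - (t powr - e) / e) \<longlongrightarrow> - 0 / e) at_top"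
    using assms by (intro tendsto_intros tendsto_neg_powr filterlim_ident) auto
  have "(\<integral>\<^sup>+t. ennreal (t powr (- 1 - e)) * indicator {s..} t \<partial>lborel) =
      ennreal (- 0 / e - (- (s powr - e) / e))"
  proof (rule nn_integral_FTC_atLeast[OF _ _ _ lim])
    fix t assume "s \<le> t"
    then have "0 < t" using assms by simp
    then show "((\<lambda>t. - (t powr - e) / e) has_real_derivative t powr (- 1 - e)) (at t)"
      using assms by (auto intro!: derivative_eq_intros simp: field_simps powr_diff powr_minus)
  qed auto
  then show ?thesis by simp
qed

text \<open>
  Below, \<open>a\<close> and \<open>b\<close> stand for the density \<open>f\<close> at \<open>x\<close> and \<open>y\<close>. The logarithmic kernel is the difference
  of the contributions of \<open>a\<close> under the cutoffs \<open>d a > 1\<close> and \<open>d \<ge> 1\<close>. At \<open>d = 0\<close> both kernels vanish.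
\<close>

definition tail_kernel :: "real \<Rightarrow> real \<Rightarrow> real \<Rightarrow> real \<Rightarrow> real" where
  "tail_kernel p a b d = (if 1 < d * a then a * b + a\<^sup>2 * (d * a) powr (- 1 - 1 / p) else 0)"

definition log_kernel :: "real \<Rightarrow> real \<Rightarrow> real" where
  "log_kernel a d = a * (of_bool (1 < d * a) - of_bool (1 \<le> d)) / d"

section \<open>Pointwise lower bound for the energy integrand\<close>

text \<open>The function \<open>?g\<close> is nondecreasing, its derivative being
  \<open>p * (1 - (1 - x) powr (p - 1))\<close>. The end point \<open>t = 1\<close> is treated apart
  because the derivative of \<open>powr\<close> is taken at a positive base.\<close>

lemma powr_Bernoulli:
  fixes t p :: real
  assumes "1 \<le> p" "0 \<le> t" "t \<le> 1"
  shows "1 - p * t \<le> (1 - t) powr p"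
proof (cases "t = 1")
  case True
  then show ?thesis using assms by simp
next
  case False
  let ?g = "\<lambda>t. (1 - t) powr p + p * t"
  have "?g 0 \<le> ?g t"
  proof (rule DERIV_nonneg_imp_nondecreasing[OF \<open>0 \<le> t\<close>])
    fix x assume x: "0 \<le> x" "x \<le> t"
    then have "x < 1" using False assms by simp
    have "(?g has_real_derivative p - p * (1 - x) powr (p - 1)) (at x)"
      using \<open>x < 1\<close> by (auto intro!: derivative_eq_intros)
    moreover have "(1 - x) powr (p - 1) \<le> 1 powr (p - 1)"
      using x \<open>x < 1\<close> assms by (intro powr_mono2) auto
    then have "0 \<le> p - p * (1 - x) powr (p - 1)"
      using assms mult_left_mono[of "(1 - x) powr (p - 1)" 1 p] by simp
    ultimately show "\<exists>y. DERIV ?g x :> y \<and> 0 \<le> y" by blast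
  qed
  then show ?thesis by simp
qed

text \<open>Bernoulli's inequality at \<open>b / a\<close>, scaled by \<open>a powr p\<close>. It
  trades the power of a difference for a power of the larger term, at the cost of a mixed
  term.\<close>

lemma powr_diff_ge:
  fixes a b p :: real
  assumes "1 \<le> p" "0 \<le> b" "b \<le> a"
  shows "a powr p - p * (a powr (p - 1) * b) \<le> (a - b) powr p"
proof (cases "a = 0")
  case True
  then show ?thesis using assms by simp
next
  case False
  with assms have a: "0 < a" by simp
  have "a powr p * (1 - p * (b / a)) \<le> a powr p * (1 - b / a) powr p"
    using a assms by (intro mult_left_mono powr_Bernoulli) auto
  also have "\<dots> = (a * (1 - b / a)) powr p"
    using a assms by (subst powr_mult) auto
  also have "a * (1 - b / a) = a - b"
    using a by (simp add: field_simps)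
  finally show ?thesis
    using a by (simp add: powr_diff algebra_simps)
qed

lemma tail_kernel_nonneg: "0 \<le> a \<Longrightarrow> 0 \<le> b \<Longrightarrow> 0 \<le> tail_kernel p a b d"
  by (simp add: tail_kernel_def)

text \<open>The two summands of \<open>tail_kernel\<close> answer the two cases of whether
  \<open>d * b\<close> reaches 1, where \<open>b\<close> is the density belonging to the smaller
  value \<open>B\<close>.\<close>

lemma mixed_term_le_tail_kernel:
  fixes A B I d p :: real
  assumes "1 < p" "0 < I" "0 < d" "0 \<le> B" "B \<le> A" and far: "1 < d * (A powr p / I)"
  shows "A powr (p - 1) * B / I / d \<le> tail_kernel p (A powr p / I) (B powr p / I) d"
proof -
  define a b where "a = A powr p / I" and "b = B powr p / I"
  define m where "m = A powr (p - 1) * B / I"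
  have A: "0 < A" using far assms by (cases "A = 0") auto
  have a: "0 < a" and b: "0 \<le> b" using A assms by (auto simp: a_def b_def)
  have ma: "m = a * (B / A)" using A by (simp add: m_def a_def powr_diff)
  have "m \<le> a"
    using mult_left_mono[of "B / A" 1 a] a A assms by (simp add: ma)
  have "m / d \<le> a * b + a\<^sup>2 * (d * a) powr (- 1 - 1 / p)"
  proof (cases "1 \<le> d * b")
    case True
    \<comment> \<open>In this case \<open>1 / d \<le> b\<close>, so the crude bound
      \<open>m \<le> a\<close> is enough.\<close>
    have "m / d \<le> a / d" using \<open>m \<le> a\<close> assms by (simp add: divide_right_mono)
    also have "\<dots> \<le> a * b" using mult_left_mono[OF True, of a] a assms by (simp add: field_simps)
    finally show ?thesis by (simp add: add_increasing2)
  next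
    case False
    \<comment> \<open>Smallness of \<open>b\<close> caps \<open>B\<close> and hence gives
      \<open>B / A \<le> (d * a) powr (- 1 / p)\<close>. This extra decay in \<open>d\<close> makes
      the bound integrable at infinity.\<close>
    have "B powr p \<le> I / d" using False assms by (simp add: b_def field_simps)
    then have "(B powr p) powr (1 / p) \<le> (I / d) powr (1 / p)"
      using assms by (intro powr_mono2) auto
    then have B: "B \<le> (I / d) powr (1 / p)" using assms by (simp add: powr_powr)
    have "(d * a) powr (1 / p) = A / (I / d) powr (1 / p)"
      using A assms by (simp add: a_def powr_mult powr_divide powr_powr field_simps)
    then have "B / A \<le> 1 / (d * a) powr (1 / p)"
      using B A by (simp add: divide_right_mono)
    then have "m \<le> a * (d * a) powr (- (1 / p))"
      using a mult_left_mono[of "B / A" "1 / (d * a) powr (1 / p)" a] by (simp add: ma powr_minus_divide)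
    moreover have "(d * a) powr (- 1 - 1 / p) = (d * a) powr (- (1 / p)) / (d * a)"
      using powr_add[of "d * a" "- 1" "- (1 / p)"] a assms by (simp add: powr_minus_divide)
    then have "a\<^sup>2 * (d * a) powr (- 1 - 1 / p) = a * (d * a) powr (- (1 / p)) / d"
      using a assms by (simp add: power2_eq_square)
    ultimately have "m / d \<le> a\<^sup>2 * (d * a) powr (- 1 - 1 / p)"
      using assms by (simp add: divide_right_mono)
    then show ?thesis using a b by (simp add: add_increasing)
  qed
  then show ?thesis
    using far by (simp add: tail_kernel_def a_def b_def m_def)
qed

text \<open>Both sides are symmetric in \<open>s\<close> and \<open>t\<close>, so
  \<open>\<bar>t\<bar> \<le> \<bar>s\<bar>\<close> may be assumed. The fixed cutoff
  \<open>1 \<le> d\<close> contributes the same term to both sides and cancels; what remains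
  compares \<open>w\<close> with the densities under their own cutoffs.\<close>

lemma difference_quotient_ge_kernels:
  fixes s t I d p :: real
  assumes "1 < p" "0 < I" "0 < d"
  shows "log_kernel (\<bar>s\<bar> powr p / I) d + log_kernel (\<bar>t\<bar> powr p / I) d
      - (p + 1) * (tail_kernel p (\<bar>s\<bar> powr p / I) (\<bar>t\<bar> powr p / I) d
                 + tail_kernel p (\<bar>t\<bar> powr p / I) (\<bar>s\<bar> powr p / I) d)
    \<le> (\<bar>s - t\<bar> powr p - of_bool (1 \<le> d) * (\<bar>s\<bar> powr p + \<bar>t\<bar> powr p)) / I / d"
  (is "?R s t \<le> ?L s t")
proof (induction "\<bar>t\<bar>" "\<bar>s\<bar>" arbitrary: s t rule: linorder_wlog)
  case sym
  then show ?case by (simp add: algebra_simps abs_minus_commute)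
next
  case le
  define A B where "A = \<bar>s\<bar>" and "B = \<bar>t\<bar>"
  have AB: "0 \<le> B" "B \<le> A" using le by (auto simp: A_def B_def)
  define a b where "a = A powr p / I" and "b = B powr p / I"
  define m where "m = A powr (p - 1) * B / I"
  define w where "w = \<bar>s - t\<bar> powr p / I"
  define c where "c = (of_bool (1 \<le> d) :: real)"
  have ab: "0 \<le> b" "b \<le> a" using AB assms by (auto simp: a_def b_def intro!: divide_right_mono powr_mono2)
  have T: "0 \<le> tail_kernel p b a d" "0 \<le> tail_kernel p a b d"
    using ab by (auto intro!: tail_kernel_nonneg)
  have w: "0 \<le> w" using assms by (simp add: w_def)
  have L: "?L s t = (w - c * (a + b)) / d"
    by (simp add: w_def c_def a_def b_def A_def B_def diff_divide_distrib add_divide_distrib)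
  have R: "?R s t = (of_bool (1 < d * a) * a + of_bool (1 < d * b) * b - c * (a + b)) / d
      - (p + 1) * (tail_kernel p a b d + tail_kernel p b a d)"
    by (simp add: log_kernel_def c_def a_def b_def A_def B_def diff_divide_distrib add_divide_distrib algebra_simps)
  show ?case
  proof (cases "1 < d * a")
    case False
    \<comment> \<open>The smaller density is then cut off as well, and \<open>0 \<le> w\<close>
      suffices.\<close>
    have "d * b \<le> d * a" using ab assms by simp
    then have "\<not> 1 < d * b" using False by simp
    moreover have "0 \<le> (p + 1) * (tail_kernel p a b d + tail_kernel p b a d)" using T assms by simp
    moreover have "- c * (a + b) / d \<le> (w - c * (a + b)) / d"
      using w assms by (intro divide_right_mono) auto
    ultimately show ?thesis unfolding L R using False by simp
  next
    case True
    have m: "m / d \<le> tail_kernel p a b d"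
      unfolding m_def a_def b_def using True assms AB by (intro mixed_term_le_tail_kernel) (auto simp: a_def)
    have "B powr (p - 1) * B \<le> A powr (p - 1) * B"
      using AB assms by (intro mult_right_mono powr_mono2) auto
    moreover have "B powr (p - 1) * B = B powr p"
      using AB by (cases "B = 0") (auto simp: powr_diff)
    ultimately have bm: "b \<le> m"
      using assms by (simp add: b_def m_def divide_right_mono)
    have "(A - B) powr p \<le> \<bar>s - t\<bar> powr p"
      using AB assms by (intro powr_mono2) (auto simp: A_def B_def)
    with powr_diff_ge[of p B A] AB assms
    have "A powr p - p * (A powr (p - 1) * B) \<le> \<bar>s - t\<bar> powr p" by simp
    then have "(A powr p - p * (A powr (p - 1) * B)) / I \<le> w"
      unfolding w_def using assms by (intro divide_right_mono) auto
    then have "a - p * m \<le> w"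
      by (simp add: a_def m_def diff_divide_distrib)
    \<comment> \<open>Origin of the factor \<open>p + 1\<close>: Bernoulli costs
      \<open>p * m\<close>, and absorbing the smaller density \<open>b\<close> costs one more
      \<open>m\<close>.\<close>
    then have "a + of_bool (1 < d * b) * b \<le> w + (p + 1) * m"
      using bm ab by (auto simp: algebra_simps)
    then have "(a + of_bool (1 < d * b) * b - c * (a + b)) / d \<le> (w + (p + 1) * m - c * (a + b)) / d"
      using assms by (intro divide_right_mono) auto
    also have "\<dots> = (w - c * (a + b)) / d + (p + 1) * (m / d)"
      by (simp add: add_divide_distrib diff_divide_distrib)
    also have "\<dots> \<le> (w - c * (a + b)) / d + (p + 1) * (tail_kernel p a b d + tail_kernel p b a d)"
      using m T assms by (intro add_left_mono mult_left_mono) auto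
    finally show ?thesis unfolding L R using True by simp
  qed
qed

section \<open>Measurability of the kernels\<close>

lemma borel_measurable_tail_kernel [measurable (raw)]:
  assumes [measurable]: "f \<in> borel_measurable M" "g \<in> borel_measurable M" "h \<in> borel_measurable M"
  shows "(\<lambda>x. tail_kernel p (f x) (g x) (h x)) \<in> borel_measurable M"
  unfolding tail_kernel_def by measurable

lemma borel_measurable_log_kernel [measurable (raw)]:
  assumes [measurable]: "f \<in> borel_measurable M" "g \<in> borel_measurable M"
  shows "(\<lambda>x. log_kernel (f x) (g x)) \<in> borel_measurable M"
  unfolding log_kernel_def of_bool_def by measurable

lemma borel_measurable_dist_power_pair [measurable]:
  "(\<lambda>z. norm (fst z - snd z) ^ n) \<in> borel_measurable (lebesgue \<Otimes>\<^sub>M (lebesgue :: 'a::euclidean_space measure))"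
proof -
  \<comment> \<open>The projections land in \<open>lebesgue\<close>; composing with the identity
    from \<open>lebesgue\<close> to \<open>borel\<close> makes them Borel functions on the
    product.\<close>
  have [measurable]: "(\<lambda>z. fst z) \<in> borel_measurable (lebesgue \<Otimes>\<^sub>M (lebesgue :: 'a measure))"
    "(\<lambda>z. snd z) \<in> borel_measurable (lebesgue \<Otimes>\<^sub>M (lebesgue :: 'a measure))"
    by (rule measurable_compose[OF measurable_fst] measurable_compose[OF measurable_snd],
        rule measurable_completion, simp)+
  show ?thesis by measurable
qed

lemma borel_measurable_dist_power [measurable]:
  "(\<lambda>y. norm (x - y) ^ n) \<in> borel_measurable (lebesgue :: 'a::euclidean_space measure)"
  by (rule measurable_completion) simp

section \<open>Integrals of the kernels in the second variable\<close>

text \<open>The product summand integrates to at most \<open>f x\<close> because \<open>f\<close>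
  has total mass 1. The other summand is radial; the substitution \<open>s = d * f x\<close> turns
  it into \<open>f x\<close> times the integral of \<open>s powr (- 1 - 1 / p)\<close> over
  \<open>s > 1\<close>, which is \<open>p\<close>, times the volume of the unit ball.\<close>

lemma nn_integral_tail_kernel_le:
  fixes f :: "'a::euclidean_space \<Rightarrow> real"
  assumes f [measurable]: "f \<in> borel_measurable lebesgue" and nonneg: "\<And>x. 0 \<le> f x"
    and one: "(\<integral>\<^sup>+x. ennreal (f x) \<partial>lebesgue) = 1" and "0 < p"
  shows "(\<integral>\<^sup>+y. ennreal (tail_kernel p (f x) (f y) (norm (x - y) ^ DIM('a))) \<partial>lebesgue)
    \<le> ennreal ((1 + unit_ball_vol DIM('a) * p) * f x)"
proof (cases "f x = 0")
  case True
  then show ?thesis by (simp add: tail_kernel_def)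
next
  case False
  define a where "a = f x"
  have a: "0 < a" using False nonneg[of x] by (simp add: a_def)
  \<comment> \<open>The radial summand with its powers of \<open>a\<close> collected; the half-line
    is closed to fit the tail integral, which adds only one point.\<close>
  let ?F = "\<lambda>t. ennreal (a powr (1 - 1 / p)) * (ennreal (t powr (- 1 - 1 / p)) * indicator {1 / a..} t)"
  have le: "ennreal (tail_kernel p a (f y) d) \<le> ennreal a * ennreal (f y) + ?F d"
    if "0 \<le> d" for y d
  proof (cases "1 < d * a")
    case True
    then have "1 / a \<le> d" using a by (simp add: field_simps)
    moreover have "d \<noteq> 0" using True by auto
    ultimately have d: "0 < d" "1 / a \<le> d" using that by simp_all
    have "a\<^sup>2 * (d * a) powr (- 1 - 1 / p) = a powr (1 - 1 / p) * d powr (- 1 - 1 / p)"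
      using a d by (simp add: powr_mult powr_diff powr_minus_divide power2_eq_square field_simps)
    then have "ennreal (tail_kernel p a (f y) d) =
        ennreal (a * f y + a powr (1 - 1 / p) * d powr (- 1 - 1 / p))"
      using True by (simp add: tail_kernel_def)
    also have "\<dots> = ennreal a * ennreal (f y) + ?F d"
      using a d nonneg by (simp add: ennreal_mult)
    finally show ?thesis by simp
  qed (simp add: tail_kernel_def)
  have "(\<integral>\<^sup>+t. ?F t * indicator {0<..} t \<partial>lborel) =
      (\<integral>\<^sup>+t. ennreal (a powr (1 - 1 / p)) * (ennreal (t powr (- 1 - 1 / p)) * indicator {1 / a..} t) \<partial>lborel)"
    using a by (auto intro!: nn_integral_cong split: split_indicator simp: order_less_le_trans[of 0 "1 / a"])
  also have "\<dots> = ennreal (a powr (1 - 1 / p)) * ennreal ((1 / a) powr - (1 / p) / (1 / p))"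
    using a assms by (subst nn_integral_cmult) (auto simp: nn_integral_powr_tail)
  also have "\<dots> = ennreal (p * (a powr (1 - 1 / p) * a powr (1 / p)))"
    using a assms by (simp add: ennreal_mult[symmetric] powr_divide powr_minus_divide ac_simps)
  also have "a powr (1 - 1 / p) * a powr (1 / p) = a"
    using a by (simp add: powr_add[symmetric])
  finally have F: "(\<integral>\<^sup>+t. ?F t * indicator {0<..} t \<partial>lborel) = ennreal (p * a)" .
  have "(\<integral>\<^sup>+y. ennreal (tail_kernel p a (f y) (norm (x - y) ^ DIM('a))) \<partial>lebesgue)
      \<le> (\<integral>\<^sup>+y. ennreal a * ennreal (f y) + ?F (norm (x - y) ^ DIM('a)) \<partial>lebesgue)"
    by (intro nn_integral_mono le) auto
  also have "\<dots> = ennreal a * 1 + (\<integral>\<^sup>+y. ?F (norm (x - y) ^ DIM('a)) \<partial>lebesgue)"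
    by (subst nn_integral_add) (auto simp: nn_integral_cmult one)
  also have "(\<integral>\<^sup>+y. ?F (norm (x - y) ^ DIM('a)) \<partial>lebesgue) = ennreal (unit_ball_vol DIM('a)) * ennreal (p * a)"
    by (subst nn_integral_norm_power_lebesgue) (auto simp: F)
  also have "ennreal a * 1 + ennreal (unit_ball_vol DIM('a)) * ennreal (p * a) =
      ennreal ((1 + unit_ball_vol DIM('a) * p) * a)"
    using a assms by (simp add: ennreal_mult[symmetric] ennreal_plus[symmetric] algebra_simps del: ennreal_plus)
  finally show ?thesis by (simp add: a_def)
qed

text \<open>For \<open>a > 1\<close> the kernel is \<open>a / d\<close> between \<open>1 / a\<close>
  and \<open>1\<close>; for \<open>0 < a \<le> 1\<close> it is \<open>- a / d\<close> between
  \<open>1\<close> and \<open>1 / a\<close>. So for almost every \<open>d\<close> it has the sign of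
  \<open>ln a\<close>, and \<open>ennreal\<close> truncates the part of the wrong sign to 0 on both
  sides.\<close>

lemma nn_integral_log_kernel:
  fixes x :: "'a::euclidean_space"
  assumes "0 \<le> a"
  shows nn_integral_log_kernel_pos:
      "(\<integral>\<^sup>+y. ennreal (log_kernel a (norm (x - y) ^ DIM('a))) \<partial>lebesgue) =
         ennreal (unit_ball_vol DIM('a) * (a * ln a))"
    and nn_integral_log_kernel_neg:
      "(\<integral>\<^sup>+y. ennreal (- log_kernel a (norm (x - y) ^ DIM('a))) \<partial>lebesgue) =
         ennreal (unit_ball_vol DIM('a) * (- (a * ln a)))"
proof -
  let ?b = "unit_ball_vol DIM('a)"
  have cmult: "(\<integral>\<^sup>+t. ennreal a * (ennreal (1 / t) * indicator {c..e} t) \<partial>lborel) = ennreal (a * ln (e / c))"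
    if "0 < c" "c \<le> e" for c e
    using that assms by (subst nn_integral_cmult) (auto simp: nn_integral_inverse_Icc ennreal_mult)
  have pos: "(\<integral>\<^sup>+t. ennreal (log_kernel a t) * indicator {0<..} t \<partial>lborel) = ennreal (a * ln a)"
  proof (cases "1 < a")
    case True
    have "(\<integral>\<^sup>+t. ennreal (log_kernel a t) * indicator {0<..} t \<partial>lborel) =
        (\<integral>\<^sup>+t. ennreal a * (ennreal (1 / t) * indicator {1 / a..1} t) \<partial>lborel)"
    \<comment> \<open>At the two ends of the closed interval the kernel is 0, so equality holds only
      off these points.\<close>
    proof (rule nn_integral_cong_AE)
      have "AE t in lborel. t \<noteq> 1 / a" "AE t in lborel. t \<noteq> (1::real)"
        by (rule AE_lborel_singleton)+
      then show "AE t in lborel. ennreal (log_kernel a t) * indicator {0<..} t =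
          ennreal a * (ennreal (1 / t) * indicator {1 / a..1} t)"
      proof eventually_elim
        case (elim t)
        consider "t \<le> 0" | "0 < t" "t < 1 / a" | "1 / a < t" "t < 1" | "1 < t"
          using elim by fastforce
        then show ?case
        proof cases
          case 1
          then have "\<not> 1 / a \<le> t" using True by (simp add: not_le order_le_less_trans)
          with 1 show ?thesis by simp
        next
          case 2
          then have "t * a < 1" "t < 1" using True by (auto simp: field_simps order_less_trans)
             (smt (verit) mult_less_cancel_left2)
          with 2 show ?thesis by (simp add: log_kernel_def)
        next
          case 3
          then have "0 < t" using True order_less_trans[of 0 "1 / a" t] by simp
          moreover have "1 < t * a" using 3 True by (simp add: field_simps)
          ultimately show ?thesis using 3 True by (simp add: log_kernel_def ennreal_mult[symmetric])
        next
          case 4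
          then have "1 < t * a" using True by (simp add: less_1_mult)
          with 4 show ?thesis by (simp add: log_kernel_def)
        qed
      qed
    qed
    then show ?thesis using cmult[of "1 / a" 1] True by simp
  next
    case False
    have z: "ennreal (log_kernel a t) * indicator {0<..} t = 0" for t
    proof (cases "0 < t")
      case True
      have "t * a \<le> t" using True False by (simp add: mult_left_le)
      then have "1 < t * a \<Longrightarrow> 1 \<le> t" by simp
      then have "log_kernel a t \<le> 0"
        using assms True by (auto simp: log_kernel_def)
      then show ?thesis by (simp add: ennreal_neg)
    qed simp
    have "a * ln a \<le> 0"
      using False assms by (cases "a = 0") (auto simp: mult_le_0_iff)
    then show ?thesis by (simp only: z) (simp add: ennreal_neg)
  qed
  have neg: "(\<integral>\<^sup>+t. ennreal (- log_kernel a t) * indicator {0<..} t \<partial>lborel) = ennreal (- (a * ln a))"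
  proof (cases "0 < a \<and> a \<le> 1")
    case True
    \<comment> \<open>Here both ends carry the value \<open>- a / t\<close>, and equality holds
      pointwise.\<close>
    have "ennreal (- log_kernel a t) * indicator {0<..} t =
        ennreal a * (ennreal (1 / t) * indicator {1..1 / a} t)" for t
    proof -
      consider "t \<le> 0" | "0 < t" "t < 1" | "1 \<le> t" "t \<le> 1 / a" | "1 \<le> t" "1 / a < t"
        by fastforce
      then show ?thesis
      proof cases
        case 2
        then have "t * a < 1" using True mult_le_one[of t a] by (smt (verit) mult_left_le)
        with 2 show ?thesis by (simp add: log_kernel_def)
      next
        case 3
        then have "\<not> 1 < t * a" using True by (simp add: field_simps)
        with 3 True show ?thesis by (simp add: log_kernel_def ennreal_mult[symmetric])
      next
        case 4
        then have "1 < t * a" using True by (simp add: field_simps)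
        with 4 True show ?thesis by (simp add: log_kernel_def)
      qed simp
    qed
    then show ?thesis using cmult[of 1 "1 / a"] True by (simp add: ln_div)
  next
    case False
    then consider "a = 0" | "1 < a" using assms by fastforce
    then show ?thesis
    proof cases
      case 2
      have z: "ennreal (- log_kernel a t) * indicator {0<..} t = 0" for t
      proof (cases "0 < t")
        case True
        have "t \<le> t * a" using True 2 by simp
        then have "1 \<le> t \<Longrightarrow> 1 < t * a" using 2 True less_le_trans[of 1 a "t * a"] by simp
        then have "0 \<le> log_kernel a t"
          using assms True by (auto simp: log_kernel_def)
        then show ?thesis by (simp add: ennreal_neg)
      qed simp
      show ?thesis using 2 by (simp only: z) (simp add: ennreal_neg)
    qed (simp add: log_kernel_def)
  qed
  show "(\<integral>\<^sup>+y. ennreal (log_kernel a (norm (x - y) ^ DIM('a))) \<partial>lebesgue) = ennreal (?b * (a * ln a))"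
    by (subst nn_integral_norm_power_lebesgue) (auto simp: pos ennreal_mult')
  show "(\<integral>\<^sup>+y. ennreal (- log_kernel a (norm (x - y) ^ DIM('a))) \<partial>lebesgue) = ennreal (?b * (- (a * ln a)))"
    by (subst nn_integral_norm_power_lebesgue, simp, subst neg, rule ennreal_mult'[symmetric], simp)
qed

lemma integral_log_kernel:
  fixes x :: "'a::euclidean_space"
  assumes "0 \<le> a"
  shows "(LINT y|lebesgue. log_kernel a (norm (x - y) ^ DIM('a))) = unit_ball_vol DIM('a) * (a * ln a)"
proof -
  have "integrable lebesgue (\<lambda>y. log_kernel a (norm (x - y) ^ DIM('a)))"
    unfolding real_integrable_def using nn_integral_log_kernel[OF assms, of x] by simp
  then have "(LINT y|lebesgue. log_kernel a (norm (x - y) ^ DIM('a))) =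
      enn2real (ennreal (unit_ball_vol DIM('a) * (a * ln a)))
      - enn2real (ennreal (unit_ball_vol DIM('a) * (- (a * ln a))))"
    by (simp add: real_lebesgue_integral_def nn_integral_log_kernel[OF assms] del: mult_minus_right)
  also have "\<dots> = unit_ball_vol DIM('a) * (a * ln a)"
    \<comment> \<open>At most one of the two truncated terms is nonzero.\<close>
    by (cases "0 \<le> unit_ball_vol DIM('a) * (a * ln a)") (auto simp: ennreal_neg)
  finally show ?thesis .
qed

section \<open>Entropy bound for a probability density\<close>

text \<open>The pointwise bound is integrated over the product, each kernel and its swapped copy
  contributing equally. Integrability of the logarithmic kernel comes first: its negative part is
  controlled by the finite measure of the support of \<open>f\<close>, and its positive part is then
  dominated through \<open>Q\<close>. By Fubini this also gives integrability of the
  entropy.\<close>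

lemma log_kernel_entropy_bound:
  fixes f :: "'a::euclidean_space \<Rightarrow> real" and Q :: "'a \<times> 'a \<Rightarrow> real"
  defines "d \<equiv> \<lambda>x y::'a. norm (x - y) ^ DIM('a)"
  assumes f [measurable]: "f \<in> borel_measurable lebesgue" and nonneg: "\<And>x. 0 \<le> f x"
    and one: "(\<integral>\<^sup>+x. ennreal (f x) \<partial>lebesgue) = 1"
    and fin: "emeasure lebesgue {x. f x \<noteq> 0} < \<infinity>" and p: "0 < p"
    and Q: "integrable (lebesgue \<Otimes>\<^sub>M lebesgue) Q"
    and ge: "\<And>x y. log_kernel (f x) (d x y) + log_kernel (f y) (d x y)
        - (p + 1) * (tail_kernel p (f x) (f y) (d x y) + tail_kernel p (f y) (f x) (d x y)) \<le> Q (x, y)"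
  shows "integrable lebesgue (\<lambda>x. f x * ln (f x))"
    and "2 * unit_ball_vol DIM('a) * (LINT x|lebesgue. f x * ln (f x))
      \<le> integral\<^sup>L (lebesgue \<Otimes>\<^sub>M lebesgue) Q + 2 * (p + 1) * (1 + unit_ball_vol DIM('a) * p)"
proof -
  let ?P = "lebesgue \<Otimes>\<^sub>M (lebesgue :: 'a measure)"
  let ?b = "unit_ball_vol DIM('a)"
  have [measurable]: "(\<lambda>z. f (fst z)) \<in> borel_measurable ?P" "(\<lambda>z. f (snd z)) \<in> borel_measurable ?P"
    "(\<lambda>z. d (fst z) (snd z)) \<in> borel_measurable ?P"
    by (auto simp: d_def)
  have dsym: "d x y = d y x" for x y by (simp add: d_def norm_minus_commute)
  define T where "T = (\<lambda>z. tail_kernel p (f (fst z)) (f (snd z)) (d (fst z) (snd z)))"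
  define K where "K = (\<lambda>z. log_kernel (f (fst z)) (d (fst z) (snd z)))"
  have [measurable]: "T \<in> borel_measurable ?P" "K \<in> borel_measurable ?P"
    by (simp_all add: T_def K_def)
  have T0: "0 \<le> T z" for z by (simp add: T_def tail_kernel_nonneg nonneg)
  have "(\<integral>\<^sup>+z. ennreal (T z) \<partial>?P) = (\<integral>\<^sup>+x. \<integral>\<^sup>+y. ennreal (T (x, y)) \<partial>lebesgue \<partial>lebesgue)"
    by (rule lebesgue.nn_integral_fst[symmetric]) simp
  also have "\<dots> \<le> (\<integral>\<^sup>+x. ennreal ((1 + ?b * p) * f x) \<partial>lebesgue)"
    unfolding T_def d_def fst_conv snd_conv
    by (intro nn_integral_mono nn_integral_tail_kernel_le f nonneg one p)
  also have "\<dots> = (\<integral>\<^sup>+x. ennreal (1 + ?b * p) * ennreal (f x) \<partial>lebesgue)"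
    using p nonneg by (simp add: ennreal_mult)
  also have "\<dots> = ennreal (1 + ?b * p)"
    by (subst nn_integral_cmult) (simp_all add: one)
  finally have Tnn: "(\<integral>\<^sup>+z. ennreal (T z) \<partial>?P) \<le> ennreal (1 + ?b * p)" .
  then have T: "integrable ?P T"
    using T0 by (intro integrableI_nonneg) (auto simp: le_less_trans[OF _ ennreal_less_top])
  have Tint: "integral\<^sup>L ?P T \<le> 1 + ?b * p"
  proof -
    have "(\<integral>\<^sup>+z. ennreal (T z) \<partial>?P) = ennreal (integral\<^sup>L ?P T)"
      using T T0 by (intro nn_integral_eq_integral) auto
    then show ?thesis using Tnn p by (simp add: ennreal_le_iff del: ennreal_plus)
  qed
  have "(\<integral>\<^sup>+z. ennreal (- K z) \<partial>?P) = (\<integral>\<^sup>+x. \<integral>\<^sup>+y. ennreal (- K (x, y)) \<partial>lebesgue \<partial>lebesgue)"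
    by (rule lebesgue.nn_integral_fst[symmetric]) simp
  also have "\<dots> = (\<integral>\<^sup>+x. ennreal (?b * (- (f x * ln (f x)))) \<partial>lebesgue)"
    unfolding K_def d_def fst_conv snd_conv by (simp only: nn_integral_log_kernel_neg[OF nonneg])
  also have "\<dots> \<le> (\<integral>\<^sup>+x. ennreal ?b * indicator {x. f x \<noteq> 0} x \<partial>lebesgue)"
  proof (intro nn_integral_mono)
    fix x
    \<comment> \<open>The inequality \<open>ln s \<le> s - 1\<close> at \<open>s = 1 / f x\<close>,
      multiplied by \<open>f x\<close>.\<close>
    have "- (f x * ln (f x)) \<le> 1" if "f x \<noteq> 0"
    proof -
      have "0 < f x" using that nonneg[of x] by simp
      moreover have "- ln (f x) \<le> 1 / f x - 1"
        using ln_le_minus_one[of "1 / f x"] \<open>0 < f x\<close> by (simp add: ln_div)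
      ultimately have "f x * (- ln (f x)) \<le> f x * (1 / f x - 1)" by (intro mult_left_mono) auto
      also have "\<dots> \<le> 1" using \<open>0 < f x\<close> by (simp add: algebra_simps)
      finally show ?thesis by simp
    qed
    then show "ennreal (?b * (- (f x * ln (f x)))) \<le> ennreal ?b * indicator {x. f x \<noteq> 0} x"
      using mult_left_mono[of "- (f x * ln (f x))" 1 ?b]
      by (auto split: split_indicator intro: ennreal_leI)
  qed
  also have "\<dots> = ennreal ?b * emeasure lebesgue {x. f x \<noteq> 0}"
    using borel_measurable_neq[OF f borel_measurable_const[of 0]]
    by (intro nn_integral_cmult_indicator) simp
  also have "\<dots> < \<infinity>" using fin by (simp add: ennreal_mult_less_top)
  finally have Knn: "(\<integral>\<^sup>+z. ennreal (- K z) \<partial>?P) < \<infinity>" .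
  have Kn: "integrable ?P (\<lambda>z. max 0 (- K z))"
  proof (rule integrableI_nonneg)
    have "ennreal (max 0 (- K z)) = ennreal (- K z)" for z
      by (simp add: max_def ennreal_neg)
    then show "(\<integral>\<^sup>+z. ennreal (max 0 (- K z)) \<partial>?P) < \<infinity>" using Knn by simp
  qed auto
  note swap = lebesgue_pair.integrable_product_swap
  \<comment> \<open>A majorant of the positive part of \<open>K\<close>: solve the pointwise bound
    for \<open>K (x, y)\<close> and replace \<open>- K (y, x)\<close> by its positive part.\<close>
  have "integrable ?P (\<lambda>z. Q z + (p + 1) * (T z + (case z of (x, y) \<Rightarrow> T (y, x)))
      + (case z of (x, y) \<Rightarrow> max 0 (- K (y, x))))"
    using swap[OF T] swap[OF Kn] T Q by (intro Bochner_Integration.integrable_add integrable_mult_right) auto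
  note R = this
  have QK: "K (x, y) + K (y, x) - (p + 1) * (T (x, y) + T (y, x)) \<le> Q (x, y)" for x y
    using ge[of x y] by (simp add: K_def T_def dsym[of y x])
  have Kp: "integrable ?P (\<lambda>z. max 0 (K z))"
  proof (rule Bochner_Integration.integrable_bound)
    show "integrable ?P (\<lambda>z. \<bar>Q z + (p + 1) * (T z + (case z of (x, y) \<Rightarrow> T (y, x)))
      + (case z of (x, y) \<Rightarrow> max 0 (- K (y, x)))\<bar>)"
      using R by (rule integrable_abs)
    have "norm (max 0 (K z)) \<le> norm \<bar>Q z + (p + 1) * (T z + (case z of (x, y) \<Rightarrow> T (y, x)))
      + (case z of (x, y) \<Rightarrow> max 0 (- K (y, x)))\<bar>" for z
      using QK[of "fst z" "snd z"] by (cases z) (auto simp: max_def)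
    then show "AE z in ?P. norm (max 0 (K z)) \<le> norm \<bar>Q z + (p + 1) * (T z + (case z of (x, y) \<Rightarrow> T (y, x)))
      + (case z of (x, y) \<Rightarrow> max 0 (- K (y, x)))\<bar>" by simp
  qed simp
  have "integrable ?P (\<lambda>z. max 0 (K z) - max 0 (- K z))"
    using Kp Kn by (rule Bochner_Integration.integrable_diff)
  also have "(\<lambda>z. max 0 (K z) - max 0 (- K z)) = K" by (auto simp: max_def)
  finally have K: "integrable ?P K" .
  have inner: "(LINT y|lebesgue. K (x, y)) = ?b * (f x * ln (f x))" for x
    unfolding K_def d_def fst_conv snd_conv by (rule integral_log_kernel[OF nonneg])
  have "integrable lebesgue (\<lambda>x. ?b * (f x * ln (f x)))"
    using lebesgue_pair.integrable_fst'[OF K] by (simp add: inner)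
  moreover have b: "0 < ?b" by simp
  ultimately show "integrable lebesgue (\<lambda>x. f x * ln (f x))"
    by (simp add: integrable_mult_left_iff)
  have Kint: "?b * (LINT x|lebesgue. f x * ln (f x)) = integral\<^sup>L ?P K"
    using lebesgue_pair.integral_fst'[OF K] by (simp add: inner)
  let ?T' = "\<lambda>(x, y). T (y, x)" and ?K' = "\<lambda>(x, y). K (y, x)"
  have T': "integrable ?P ?T'" "integral\<^sup>L ?P ?T' = integral\<^sup>L ?P T"
    using swap[OF T] lebesgue_pair.integral_product_swap[of T] by auto
  have K': "integrable ?P ?K'" "integral\<^sup>L ?P ?K' = integral\<^sup>L ?P K"
    using swap[OF K] lebesgue_pair.integral_product_swap[of K] by auto
  \<comment> \<open>With all integrands now known to be integrable, swapping the variables merges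
    the two copies and yields the factor 2.\<close>
  have "integral\<^sup>L ?P (\<lambda>z. K z + ?K' z) \<le> integral\<^sup>L ?P (\<lambda>z. Q z + (p + 1) * (T z + ?T' z))"
  proof (rule integral_mono)
    show "K z + ?K' z \<le> Q z + (p + 1) * (T z + ?T' z)" for z
      using QK[of "fst z" "snd z"] by (cases z) auto
  qed (use T K Q T'(1) K'(1) in \<open>auto intro!: Bochner_Integration.integrable_add integrable_mult_right\<close>)
  then have "2 * integral\<^sup>L ?P K \<le> integral\<^sup>L ?P Q + (p + 1) * (2 * integral\<^sup>L ?P T)"
    using T K Q T' K' by simp
  also have "\<dots> \<le> integral\<^sup>L ?P Q + (p + 1) * (2 * (1 + ?b * p))"
    using Tint p by (intro add_left_mono mult_left_mono) auto
  finally show "2 * ?b * (LINT x|lebesgue. f x * ln (f x)) \<le> integral\<^sup>L ?P Q + 2 * (p + 1) * (1 + ?b * p)"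
    by (simp add: Kint[symmetric] algebra_simps)
qed

section \<open>Energies with equal arguments and the normalising constant\<close>

lemma h_fun_mult_self: "h_fun p t * t = \<bar>t\<bar> powr p"
proof (cases "t = 0")
  case False
  have "h_fun p t * t = \<bar>t\<bar> powr (p - 2) * \<bar>t\<bar> powr 2"
    using False by (simp add: h_fun_def power2_eq_square)
  also have "\<dots> = \<bar>t\<bar> powr p" by (simp only: powr_add[symmetric]) simp
  finally show ?thesis .
qed (simp add: h_fun_def)

lemma Upsilon_diag:
  "Upsilon p s t s t = \<bar>s - t\<bar> powr p - \<bar>s\<bar> powr p - \<bar>t\<bar> powr p"
  by (simp add: Upsilon_def h_fun_mult_self)

text \<open>If one argument is 0, the two remaining powers cancel. This confines the far integrand
  to pairs from the support of \<open>u\<close>.\<close>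

lemma abs_Upsilon_diag_le:
  assumes "0 < p"
  shows "\<bar>Upsilon p s t s t\<bar> \<le> (2 powr p + 1) * (\<bar>s\<bar> powr p + \<bar>t\<bar> powr p) * of_bool (s \<noteq> 0 \<and> t \<noteq> 0)"
proof (cases "s \<noteq> 0 \<and> t \<noteq> 0")
  case True
  have "\<bar>s - t\<bar> powr p \<le> (2 * max \<bar>s\<bar> \<bar>t\<bar>) powr p"
    using assms by (intro powr_mono2) auto
  also have "\<dots> = 2 powr p * max \<bar>s\<bar> \<bar>t\<bar> powr p" by (simp add: powr_mult)
  also have "\<dots> \<le> 2 powr p * (\<bar>s\<bar> powr p + \<bar>t\<bar> powr p)"
    by (intro mult_left_mono) (auto simp: max_def)
  finally have "\<bar>s - t\<bar> powr p \<le> 2 powr p * (\<bar>s\<bar> powr p + \<bar>t\<bar> powr p)" .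
  moreover have "0 \<le> \<bar>s - t\<bar> powr p" "0 \<le> \<bar>s\<bar> powr p" "0 \<le> \<bar>t\<bar> powr p"
    "0 \<le> 2 powr p * (\<bar>s\<bar> powr p + \<bar>t\<bar> powr p)" by auto
  ultimately have "\<bar>\<bar>s - t\<bar> powr p - \<bar>s\<bar> powr p - \<bar>t\<bar> powr p\<bar> \<le>
      2 powr p * (\<bar>s\<bar> powr p + \<bar>t\<bar> powr p) + (\<bar>s\<bar> powr p + \<bar>t\<bar> powr p)"
    by (simp only: abs_le_iff) linarith
  then show ?thesis using True by (simp add: Upsilon_diag algebra_simps)
qed (auto simp: Upsilon_diag)

lemma C_const_pos: "0 < p \<Longrightarrow> 0 < N \<Longrightarrow> 0 < C_const N p"
  by (simp add: C_const_def Gamma_real_pos)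

text \<open>The recurrence \<open>Gamma (z + 1) = z * Gamma z\<close> at \<open>z = N / 2\<close>
  cancels the Gamma factors and the powers of \<open>pi\<close>.\<close>

lemma C_const_unit_ball_vol:
  assumes "0 < N"
  shows "C_const N p * unit_ball_vol N = p / N"
proof -
  have "real N / 2 \<notin> \<int>\<^sub>\<le>\<^sub>0"
    using assms nonpos_Ints_nonpos[of "real N / 2"] by auto
  then have "Gamma (real N / 2 + 1) = real N / 2 * Gamma (real N / 2)"
    by (rule Gamma_plus1)
  moreover have "Gamma (real N / 2) > 0" using assms by (intro Gamma_real_pos) simp
  ultimately show ?thesis by (simp add: C_const_def unit_ball_vol_def field_simps)
qed

text \<open>The cutoff becomes a factor of the integrand, so that the near and far parts can be
  added as functions on one product space.\<close>

lemma E_near_diag_eq: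
  fixes u :: "real ^ 'n \<Rightarrow> real"
  shows "E_near p u u = C_const CARD('n) p / 2 *
    (LINT z|(lebesgue \<Otimes>\<^sub>M lebesgue). of_bool (norm (fst z - snd z) \<le> 1) *
      (\<bar>u (fst z) - u (snd z)\<bar> powr p / norm (fst z - snd z) ^ CARD('n)))"
  unfolding E_near_def set_lebesgue_integral_def
  by (intro arg_cong2[where f="(*)"] Bochner_Integration.integral_cong)
     (auto simp: h_fun_mult_self indicator_def)

lemma F_far_diag_eq:
  fixes u :: "real ^ 'n \<Rightarrow> real"
  shows "F_far p u u = C_const CARD('n) p / 2 *
    (LINT z|(lebesgue \<Otimes>\<^sub>M lebesgue). of_bool (1 \<le> norm (fst z - snd z)) *
      (Upsilon p (u (fst z)) (u (snd z)) (u (fst z)) (u (snd z)) / norm (fst z - snd z) ^ CARD('n)))"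
  unfolding F_far_def set_lebesgue_integral_def
  by (intro arg_cong2[where f="(*)"] Bochner_Integration.integral_cong)
     (auto simp: indicator_def)

section \<open>Measurability and integrability in the energy space\<close>

text \<open>Lebesgue measure is complete, so agreeing almost everywhere with the measurable
  truncation of \<open>u\<close> to \<Omega> is enough.\<close>

lemma borel_measurable_of_AE_zero_outside:
  fixes u :: "'a::euclidean_space \<Rightarrow> real"
  assumes "u \<in> borel_measurable (lebesgue_on \<Omega>)" "\<Omega> \<in> sets lebesgue"
    and ae: "AE x in lebesgue. x \<notin> \<Omega> \<longrightarrow> u x = 0"
  shows "u \<in> borel_measurable lebesgue"
proof -
  have "(\<lambda>x. indicator \<Omega> x *\<^sub>R u x) \<in> borel_measurable lebesgue"
    using assms by (subst borel_measurable_restrict_space_iff[symmetric]) auto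
  moreover have "AE x in lebesgue. indicator \<Omega> x *\<^sub>R u x = u x"
    using ae by eventually_elim (auto simp: indicator_def)
  ultimately show ?thesis by (rule borel_measurable_AE)
qed

locale X_element =
  fixes p :: real and \<Omega> :: "(real ^ 'n) set" and u :: "real ^ 'n \<Rightarrow> real"
  assumes p: "1 < p" and open_\<Omega>: "open \<Omega>" and bounded_\<Omega>: "bounded \<Omega>" and X: "u \<in> X_space p \<Omega>"
begin

lemma zero_outside: "AE x in lebesgue. x \<notin> \<Omega> \<longrightarrow> u x = 0"
  using X by (simp add: X_space_def)

lemma \<Omega>_sets: "\<Omega> \<in> sets lebesgue"
  using open_\<Omega> by simp

lemma measurable_u [measurable]: "u \<in> borel_measurable lebesgue"
  using X \<Omega>_sets by (intro borel_measurable_of_AE_zero_outside[of _ \<Omega>]) (auto simp: X_space_def in_Lp_def)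

text \<open>Because \<open>g 0 = 0\<close>, the composition vanishes almost everywhere outside
  \<Omega>. It transfers both the power and the entropy integrand to the whole space.\<close>

lemma lebesgue_on_eq_lebesgue:
  fixes g :: "real \<Rightarrow> real"
  assumes [measurable]: "g \<in> borel_measurable borel" and "g 0 = 0"
  shows "integrable (lebesgue_on \<Omega>) (\<lambda>x. g (u x)) \<longleftrightarrow> integrable lebesgue (\<lambda>x. g (u x))"
    and "(LINT x|lebesgue_on \<Omega>. g (u x)) = (LINT x|lebesgue. g (u x))"
proof -
  have ae: "AE x in lebesgue. indicator \<Omega> x *\<^sub>R g (u x) = g (u x)"
    using zero_outside by eventually_elim (auto simp: indicator_def assms)
  have [measurable]: "\<Omega> \<in> sets lebesgue" by (rule \<Omega>_sets)
  show "integrable (lebesgue_on \<Omega>) (\<lambda>x. g (u x)) \<longleftrightarrow> integrable lebesgue (\<lambda>x. g (u x))"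
    by (subst integrable_restrict_space, simp add: \<Omega>_sets, intro integrable_cong_AE) (use ae in auto)
  show "(LINT x|lebesgue_on \<Omega>. g (u x)) = (LINT x|lebesgue. g (u x))"
    by (subst integral_restrict_space, simp add: \<Omega>_sets, intro integral_cong_AE) (use ae in auto)
qed

lemma integrable_powr: "integrable lebesgue (\<lambda>x. \<bar>u x\<bar> powr p)"
  using X lebesgue_on_eq_lebesgue(1)[of "\<lambda>t. \<bar>t\<bar> powr p"] by (auto simp: X_space_def in_Lp_def)

text \<open>Up to a null set the support lies in the bounded set \<Omega>. This controls the
  negative part of the entropy and the far energy.\<close>

lemma emeasure_support: "emeasure lebesgue {x. u x \<noteq> 0} < \<infinity>"
proof -
  have "emeasure lebesgue {x. u x \<noteq> 0} \<le> emeasure lebesgue \<Omega>"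
    using zero_outside \<Omega>_sets by (intro emeasure_mono_AE) auto
  also have "\<dots> < \<infinity>" using emeasure_bounded_finite[OF bounded_\<Omega>] open_\<Omega> by simp
  finally show ?thesis .
qed

lemma support_sets [measurable]: "{x. u x \<noteq> 0} \<in> sets lebesgue"
  using borel_measurable_neq[OF measurable_u borel_measurable_const[of 0]] by simp

lemma measurable_pair_u [measurable]:
  "(\<lambda>z. u (fst z)) \<in> borel_measurable (lebesgue \<Otimes>\<^sub>M lebesgue)"
  "(\<lambda>z. u (snd z)) \<in> borel_measurable (lebesgue \<Otimes>\<^sub>M lebesgue)"
  by measurable

lemma measurable_pair_norm [measurable]:
  "(\<lambda>z. norm (fst z - snd z)) \<in> borel_measurable (lebesgue \<Otimes>\<^sub>M (lebesgue :: (real ^ 'n) measure))"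
  using borel_measurable_dist_power_pair[of 1] by simp

text \<open>The integral of this nonnegative function is the finite seminorm power up to the
  positive factor \<open>C_const\<close>.\<close>

lemma integrable_near:
  "integrable (lebesgue \<Otimes>\<^sub>M lebesgue) (\<lambda>z. of_bool (norm (fst z - snd z) \<le> 1) *
      (\<bar>u (fst z) - u (snd z)\<bar> powr p / norm (fst z - snd z) ^ CARD('n)))"
    (is "integrable ?P ?g")
proof (rule integrableI_nonneg)
  show "?g \<in> borel_measurable ?P" unfolding of_bool_def by measurable
  have "X_seminorm_pow p u = ennreal (C_const CARD('n) p) * (\<integral>\<^sup>+z. ennreal (?g z) \<partial>?P)"
    unfolding X_seminorm_pow_def
    by (intro arg_cong2[where f="(*)"] nn_integral_cong) (auto simp: indicator_def)
  moreover have "X_seminorm_pow p u < \<infinity>" using X by (simp add: X_space_def)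
  moreover have "0 < C_const CARD('n) p" using p by (intro C_const_pos) auto
  ultimately show "(\<integral>\<^sup>+z. ennreal (?g z) \<partial>?P) < \<infinity>"
    by (auto simp: ennreal_mult_less_top)
qed auto

text \<open>On the far region the singular factor is at most 1, and \<open>Upsilon\<close> lives on
  pairs from the support. The majorant \<open>G\<close> integrates to the mass of \<open>u\<close>
  times the measure of the support.\<close>

lemma integrable_far:
  "integrable (lebesgue \<Otimes>\<^sub>M lebesgue) (\<lambda>z. of_bool (1 \<le> norm (fst z - snd z)) *
      (Upsilon p (u (fst z)) (u (snd z)) (u (fst z)) (u (snd z)) / norm (fst z - snd z) ^ CARD('n)))"
    (is "integrable ?P ?g")
proof (rule Bochner_Integration.integrable_bound)
  let ?S = "{x. u x \<noteq> 0}"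
  define G where "G = (\<lambda>z::(real ^ 'n) \<times> (real ^ 'n). \<bar>u (fst z)\<bar> powr p * indicator ?S (snd z))"
  have [measurable]: "G \<in> borel_measurable ?P" unfolding G_def by measurable
  have G: "integrable ?P G"
  proof (rule integrableI_nonneg)
    have "(\<integral>\<^sup>+z. ennreal (G z) \<partial>?P) = (\<integral>\<^sup>+x. \<integral>\<^sup>+y. ennreal (G (x, y)) \<partial>lebesgue \<partial>lebesgue)"
      by (rule lebesgue.nn_integral_fst[symmetric]) simp
    also have "\<dots> = (\<integral>\<^sup>+x. ennreal (\<bar>u x\<bar> powr p) * emeasure lebesgue ?S \<partial>lebesgue)"
      by (intro nn_integral_cong, subst nn_integral_cmult_indicator[symmetric])
         (auto simp: G_def intro!: nn_integral_cong split: split_indicator)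
    also have "\<dots> = (\<integral>\<^sup>+x. ennreal (\<bar>u x\<bar> powr p) \<partial>lebesgue) * emeasure lebesgue ?S"
      by (rule nn_integral_multc) simp
    also have "\<dots> < \<infinity>"
      using emeasure_support integrable_powr
      by (auto simp: ennreal_mult_less_top integrable_iff_bounded)
    finally show "(\<integral>\<^sup>+z. ennreal (G z) \<partial>?P) < \<infinity>" .
  qed (auto simp: G_def)
  show "integrable ?P (\<lambda>z. (2 powr p + 1) * (G z + (case z of (x, y) \<Rightarrow> G (y, x))))"
    using G lebesgue_pair.integrable_product_swap[OF G] by auto
  show "?g \<in> borel_measurable ?P" unfolding of_bool_def Upsilon_diag by measurable
  have "norm (?g z) \<le> norm ((2 powr p + 1) * (G z + (case z of (x, y) \<Rightarrow> G (y, x))))" for z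
  proof (cases z)
    case (Pair x y)
    have *: "\<bar>Upsilon p (u x) (u y) (u x) (u y)\<bar> \<le> (2 powr p + 1) * (G (x, y) + G (y, x))"
      using abs_Upsilon_diag_le[of p "u x" "u y"] p
      by (auto simp: G_def indicator_def split: if_splits)
    have "norm (?g z) \<le> \<bar>Upsilon p (u x) (u y) (u x) (u y)\<bar>"
    proof (cases "1 \<le> norm (x - y)")
      case True
      then have "1 \<le> norm (x - y) ^ CARD('n)" by (rule one_le_power)
      then show ?thesis using True
        by (simp add: Pair abs_divide divide_le_eq mult_left_le_one_le) (simp add: mult_le_cancel_left1)
    qed (simp add: Pair)
    also note *
    finally show ?thesis by (simp add: Pair)
  qed
  then show "AE z in ?P. norm (?g z) \<le> norm ((2 powr p + 1) * (G z + (case z of (x, y) \<Rightarrow> G (y, x))))"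
    by simp
qed

section \<open>The inequality for a single function\<close>

abbreviation mass :: real where "mass \<equiv> LINT x|lebesgue. \<bar>u x\<bar> powr p"

text \<open>Separated from the main case, which divides by the mass: here both arguments vanish at
  almost every pair, so every energy term is 0.\<close>

lemma E_log_zero_mass:
  assumes "mass = 0"
  shows "AE x in lebesgue. u x = 0" and "E_log p u u = 0"
proof -
  show ae: "AE x in lebesgue. u x = 0"
    using assms integral_nonneg_eq_0_iff_AE[OF integrable_powr] by simp
  let ?P = "lebesgue \<Otimes>\<^sub>M (lebesgue :: (real ^ 'n) measure)"
  have pair: "AE z in ?P. u (fst z) = 0 \<and> u (snd z) = 0"
  proof (rule lebesgue_pair.AE_pair_measure)
    show "AE x in lebesgue. AE y in lebesgue. u (fst (x, y)) = 0 \<and> u (snd (x, y)) = 0"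
      using ae
    proof eventually_elim
      case (elim x)
      show ?case using ae by eventually_elim (simp add: elim)
    qed
  qed measurable
  have "E_near p u u = 0"
    unfolding E_near_diag_eq
    by (subst integral_eq_zero_AE) (use pair in \<open>auto elim: eventually_mono\<close>)
  moreover have "F_far p u u = 0"
    unfolding F_far_diag_eq Upsilon_diag
    by (subst integral_eq_zero_AE) (use pair in \<open>auto elim: eventually_mono\<close>)
  ultimately show "E_log p u u = 0"
    using assms by (simp add: E_log_def h_fun_mult_self)
qed

text \<open>The entropy bound applied to the normalised density \<open>f\<close> and the normalised
  energy integrand \<open>Q\<close>, then rescaled by the mass and by half of
  \<open>C_const\<close>.\<close>

lemma entropy_le_energy:
  assumes "0 < mass"
  shows "integrable lebesgue (\<lambda>x. \<bar>u x\<bar> powr p * ln \<bar>u x\<bar>)"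
    and "p / CARD('n) * (p * (LINT x|lebesgue. \<bar>u x\<bar> powr p * ln \<bar>u x\<bar>) - mass * ln mass)
      \<le> E_near p u u + F_far p u u
        + C_const CARD('n) p * (p + 1) * (1 + unit_ball_vol CARD('n) * p) * mass"
proof -
  let ?P = "lebesgue \<Otimes>\<^sub>M (lebesgue :: (real ^ 'n) measure)"
  define I where "I = mass"
  have I: "0 < I" using assms by (simp add: I_def)
  define b where "b = unit_ball_vol CARD('n)"
  define f where "f = (\<lambda>x. \<bar>u x\<bar> powr p / I)"
  define near where "near = (\<lambda>z. of_bool (norm (fst z - snd z) \<le> 1) *
      (\<bar>u (fst z) - u (snd z)\<bar> powr p / norm (fst z - snd z) ^ CARD('n)))"
  define far where "far = (\<lambda>z. of_bool (1 \<le> norm (fst z - snd z)) *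
      (Upsilon p (u (fst z)) (u (snd z)) (u (fst z)) (u (snd z)) / norm (fst z - snd z) ^ CARD('n)))"
  define Q where "Q = (\<lambda>z. (near z + far z) / I)"
  have near: "integrable ?P near" and far: "integrable ?P far"
    unfolding near_def far_def by (rule integrable_near integrable_far)+
  have Q: "integrable ?P Q" unfolding Q_def using near far by auto
  have one: "(\<integral>\<^sup>+x. ennreal (f x) \<partial>lebesgue) = 1"
  proof -
    have "(\<integral>\<^sup>+x. ennreal (f x) \<partial>lebesgue) = ennreal (LINT x|lebesgue. f x)"
      using integrable_powr I by (intro nn_integral_eq_integral) (auto simp: f_def)
    then show ?thesis using I by (simp add: f_def I_def[symmetric])
  qed
  have ge: "log_kernel (f x) (norm (x - y) ^ DIM(real ^ 'n)) + log_kernel (f y) (norm (x - y) ^ DIM(real ^ 'n))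
      - (p + 1) * (tail_kernel p (f x) (f y) (norm (x - y) ^ DIM(real ^ 'n))
                 + tail_kernel p (f y) (f x) (norm (x - y) ^ DIM(real ^ 'n))) \<le> Q (x, y)" for x y
  proof (cases "x = y")
    \<comment> \<open>On the diagonal both sides are 0, division by zero giving 0.\<close>
    case True
    then show ?thesis by (simp add: log_kernel_def tail_kernel_def Q_def near_def far_def zero_power)
  next
    case False
    define d where "d = norm (x - y) ^ CARD('n)"
    have d: "0 < d" using False by (simp add: d_def)
    have d1: "1 \<le> norm (x - y) \<longleftrightarrow> 1 \<le> d" "norm (x - y) \<le> 1 \<longleftrightarrow> d \<le> 1"
      using power_mono_iff[of 1 "norm (x - y)" "CARD('n)"] power_mono_iff[of "norm (x - y)" 1 "CARD('n)"]
      by (simp_all add: d_def)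
    have "log_kernel (f x) d + log_kernel (f y) d - (p + 1) * (tail_kernel p (f x) (f y) d + tail_kernel p (f y) (f x) d)
      \<le> (\<bar>u x - u y\<bar> powr p - of_bool (1 \<le> d) * (\<bar>u x\<bar> powr p + \<bar>u y\<bar> powr p)) / I / d"
      unfolding f_def using difference_quotient_ge_kernels[OF p I d] .
    also have "\<dots> = (\<bar>u x - u y\<bar> powr p - of_bool (1 \<le> d) * (\<bar>u x\<bar> powr p + \<bar>u y\<bar> powr p)) / d / I"
      by simp
    \<comment> \<open>The sphere \<open>d = 1\<close> lies in both regions; there the extra summand is nonnegative.\<close>
    also have "\<dots> \<le> (of_bool (d \<le> 1) * (\<bar>u x - u y\<bar> powr p / d)
        + of_bool (1 \<le> d) * ((\<bar>u x - u y\<bar> powr p - \<bar>u x\<bar> powr p - \<bar>u y\<bar> powr p) / d)) / I"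
      using d I by (intro divide_right_mono) (auto simp: diff_divide_distrib add_divide_distrib)
    also have "\<dots> = Q (x, y)"
      by (simp add: Q_def near_def far_def d_def[symmetric] d1 Upsilon_diag)
    finally show ?thesis by (simp add: d_def)
  qed
  have f: "f \<in> borel_measurable lebesgue" "0 \<le> f x" for x
    using I by (auto simp: f_def)
  have fin: "emeasure lebesgue {x. f x \<noteq> 0} < \<infinity>"
    using emeasure_support I by (simp add: f_def)
  have p0: "0 < p" using p by simp
  note main = log_kernel_entropy_bound[OF f one fin p0 Q ge]
  \<comment> \<open>At zeros of \<open>u\<close> this holds because all the powers vanish; elsewhere
    the logarithm of the quotient splits.\<close>
  have flnf: "f x * ln (f x) = p / I * (\<bar>u x\<bar> powr p * ln \<bar>u x\<bar>) - ln I / I * \<bar>u x\<bar> powr p" for x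
    using I by (cases "u x = 0") (auto simp: f_def ln_div ln_powr field_simps)
  have int: "integrable lebesgue (\<lambda>x. p / I * (\<bar>u x\<bar> powr p * ln \<bar>u x\<bar>) - ln I / I * \<bar>u x\<bar> powr p)"
    using main(1) by (simp add: flnf)
  \<comment> \<open>Adding back an integrable multiple of the power of \<open>u\<close> isolates the
    logarithmic term.\<close>
  have "integrable lebesgue (\<lambda>x. (p / I * (\<bar>u x\<bar> powr p * ln \<bar>u x\<bar>) - ln I / I * \<bar>u x\<bar> powr p)
      + ln I / I * \<bar>u x\<bar> powr p)"
    using int integrable_powr by (intro Bochner_Integration.integrable_add integrable_mult_right) auto
  then have "integrable lebesgue (\<lambda>x. p / I * (\<bar>u x\<bar> powr p * ln \<bar>u x\<bar>))" by simp
  then show J: "integrable lebesgue (\<lambda>x. \<bar>u x\<bar> powr p * ln \<bar>u x\<bar>)"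
    using p I by (subst (asm) integrable_mult_left_iff) auto
  define J where "J = (LINT x|lebesgue. \<bar>u x\<bar> powr p * ln \<bar>u x\<bar>)"
  have "(LINT x|lebesgue. f x * ln (f x)) = p / I * J - ln I / I * I"
    unfolding flnf J_def I_def using J integrable_powr
    by (subst Bochner_Integration.integral_diff) auto
  then have fint: "(LINT x|lebesgue. f x * ln (f x)) = (p * J - I * ln I) / I"
    using I by (simp add: field_simps)
  have "integral\<^sup>L ?P Q = (integral\<^sup>L ?P near + integral\<^sup>L ?P far) / I"
    unfolding Q_def using near far by simp
  with main(2) have "2 * b * ((p * J - I * ln I) / I) \<le>
      (integral\<^sup>L ?P near + integral\<^sup>L ?P far) / I + 2 * (p + 1) * (1 + b * p)"
    by (simp add: fint b_def)
  from mult_right_mono[OF this, of I] I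
  have le: "2 * b * (p * J - I * ln I) \<le>
      integral\<^sup>L ?P near + integral\<^sup>L ?P far + 2 * (p + 1) * (1 + b * p) * I"
    by (simp add: distrib_right add_divide_distrib)
  define c where "c = C_const CARD('n) p"
  have c: "0 < c" unfolding c_def using p by (intro C_const_pos) auto
  have cb: "c * b = p / CARD('n)" unfolding c_def b_def by (rule C_const_unit_ball_vol) simp
  \<comment> \<open>The factor \<open>c / 2\<close> is the prefactor of both energies, and it turns
    \<open>2 * b\<close> into \<open>p / CARD('n)\<close>.\<close>
  have "p / CARD('n) * (p * J - I * ln I) = c / 2 * (2 * b * (p * J - I * ln I))"
    by (simp add: cb[symmetric])
  also have "\<dots> \<le> c / 2 * (integral\<^sup>L ?P near + integral\<^sup>L ?P far + 2 * (p + 1) * (1 + b * p) * I)"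
    using c le by (intro mult_left_mono) auto
  also have "\<dots> = E_near p u u + F_far p u u + c * (p + 1) * (1 + b * p) * I"
    unfolding E_near_diag_eq F_far_diag_eq near_def far_def c_def by (simp add: algebra_simps)
  finally show "p / CARD('n) * (p * (LINT x|lebesgue. \<bar>u x\<bar> powr p * ln \<bar>u x\<bar>) - mass * ln mass)
      \<le> E_near p u u + F_far p u u
        + C_const CARD('n) p * (p + 1) * (1 + unit_ball_vol CARD('n) * p) * mass"
    by (simp add: I_def J_def c_def b_def)
qed

text \<open>The logarithm of the norm is that of the mass divided by \<open>p\<close>, which turns
  the mass term into the norm term. Since \<open>E_log\<close> adds \<open>rho_const\<close> times
  the mass to the near and far energies, \<open>k\<close> subtracts it again.\<close>

lemma log_Sobolev:
  defines "k \<equiv> C_const CARD('n) p * (p + 1) * (1 + unit_ball_vol CARD('n) * p) - rho_const CARD('n) p"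
  shows "integrable (lebesgue_on \<Omega>) (\<lambda>x. \<bar>u x\<bar> powr p * ln \<bar>u x\<bar>) \<and>
      p\<^sup>2 / real CARD('n) * (LINT x|lebesgue_on \<Omega>. \<bar>u x\<bar> powr p * ln \<bar>u x\<bar>)
        \<le> E_log p u u
          + p\<^sup>2 / real CARD('n) * (Lp_norm p \<Omega> u powr p * ln (Lp_norm p \<Omega> u))
          + k * Lp_norm p \<Omega> u powr p"
proof -
  \<comment> \<open>The condition at 0 holds since \<open>0 powr p = 0\<close>, which realises the
    convention for the entropy integrand.\<close>
  note entropy_on = lebesgue_on_eq_lebesgue[of "\<lambda>t. \<bar>t\<bar> powr p * ln \<bar>t\<bar>", simplified]
  have norm: "Lp_norm p \<Omega> u = mass powr (1 / p)"
    using lebesgue_on_eq_lebesgue(2)[of "\<lambda>t. \<bar>t\<bar> powr p"] by (simp add: Lp_norm_def)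
  have "0 \<le> mass" by simp
  then consider "mass = 0" | "0 < mass" by linarith
  then show ?thesis
  proof cases
    case 1
    have "AE x in lebesgue. \<bar>u x\<bar> powr p * ln \<bar>u x\<bar> = 0"
      using E_log_zero_mass(1)[OF 1] by eventually_elim simp
    then have "integrable lebesgue (\<lambda>x. \<bar>u x\<bar> powr p * ln \<bar>u x\<bar>)"
      "(LINT x|lebesgue. \<bar>u x\<bar> powr p * ln \<bar>u x\<bar>) = 0"
      by (auto intro: integral_eq_zero_AE simp: integrable_cong_AE[of _ _ "\<lambda>_. 0"])
    then show ?thesis
      by (simp add: entropy_on norm 1 E_log_zero_mass(2))
  next
    case 2
    have ln_norm: "ln (mass powr (1 / p)) = ln mass / p" "(mass powr (1 / p)) powr p = mass"
      using 2 p by (simp_all add: ln_powr powr_powr)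
    have E: "E_log p u u = E_near p u u + F_far p u u + rho_const CARD('n) p * mass"
      by (simp add: E_log_def h_fun_mult_self)
    define J where "J = (LINT x|lebesgue. \<bar>u x\<bar> powr p * ln \<bar>u x\<bar>)"
    have "p\<^sup>2 / CARD('n) * J = p / CARD('n) * (p * J - mass * ln mass) + p\<^sup>2 / CARD('n) * (mass * (ln mass / p))"
      using p by (simp add: field_simps power2_eq_square)
    also have "p / CARD('n) * (p * J - mass * ln mass) \<le> E_log p u u + k * mass"
      using entropy_le_energy(2)[OF 2] unfolding E k_def J_def by (simp add: algebra_simps)
    finally show ?thesis
      using entropy_le_energy(1)[OF 2] by (simp add: entropy_on norm ln_norm J_def)
  qed
qed

end

theorem theorem2p5:
  fixes p :: real
  assumes "1 < p"
  shows "\<exists>k0::real. \<forall>(\<Omega> :: (real ^ 'n) set) u.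
    open \<Omega> \<longrightarrow> bounded \<Omega> \<longrightarrow> u \<in> X_space p \<Omega> \<longrightarrow>
      integrable (lebesgue_on \<Omega>) (\<lambda>x. \<bar>u x\<bar> powr p * ln \<bar>u x\<bar>) \<and>
      p\<^sup>2 / real CARD('n) * (LINT x|lebesgue_on \<Omega>. \<bar>u x\<bar> powr p * ln \<bar>u x\<bar>)
        \<le> E_log p u u
          + p\<^sup>2 / real CARD('n) * (Lp_norm p \<Omega> u powr p * ln (Lp_norm p \<Omega> u))
          + k0 * Lp_norm p \<Omega> u powr p"
  \<comment> \<open>The constant \<open>k\<close> is built from \<open>CARD('n)\<close> and
    \<open>p\<close> alone, so one witness serves all \<Omega> and \<open>u\<close>.\<close>
  using X_element.log_Sobolev[OF X_element.intro, OF assms] by blast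

end
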